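(* If an $n$-point Lebesgue quadrature is constructed for a measure $d\mu$ and a function $f(x)$, then any integral $\langle P(x)f(x)\rangle=\int P(x)f(x)\,d\mu$, where $P(x)$ is a polynomial of degree $2n-2$ or less, can be evaluated from it exactly.
   Context: Let $n\ge 1$, let $\mu$ be a measure on the real line, $f$ a real function, and $Q_0,Q_1,\dots$ a basis of real polynomials with $\deg Q_k=k$. Write $\langle g\rangle=\int g\,d\mu$, $\langle g|h\rangle=\int gh\,d\mu$ and $\langle g|f|h\rangle=\int gfh\,d\mu$. The moments $\langle Q_j|Q_k\rangle$ and $\langle Q_j|f|Q_k\rangle$, $0\le j,k\le n-1$, are assumed finite, and the matrix $\big(\langle Q_j|Q_k\rangle\big)_{j,k=0}^{n-1}$ is assumed positive definite. Lebesgue quadrature: consider the generalized eigenvalue problem $$\sum_{k=0}^{n-1}\langle Q_j|f|Q_k\rangle\,\alpha^{[i]}_k=\lambda^{[i]}\sum_{k=0}^{n-1}\langle Q_j|Q_k\rangle\,\alpha^{[i]}_k,\qquad j=0,\dots,n-1,$$ with eigenfunctions $\psi^{[i]}(x)=\sum_{k=0}^{n-1}\alpha^{[i]}_kQ_k(x)$, $i=0,\dots,n-1$, normalized so that $\langle\psi^{[i]}|\psi^{[j]}\rangle=\delta_{ij}$ and hence $\langle\psi^{[i]}|f|\psi^{[j]}\rangle=\lambda^{[i]}\delta_{ij}$. The $n$-point Lebesgue quadrature for $\mu$ and $f$, with $\int f\,d\mu\approx\sum_{i=0}^{n-1}f^{[i]}w^{[i]}$, has value-nodes $f^{[i]}=\lambda^{[i]}$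 and weights $w^{[i]}=\langle\psi^{[i]}\rangle^2$. The quadrature is completely defined by, and is understood as given by, the $n$ pairs $(\lambda^{[i]},\psi^{[i]})$. *)

theory Defs
  imports "HOL-Analysis.Analysis" "HOL-Computational_Algebra.Polynomial"
begin

definition mean :: "real measure \<Rightarrow> (real \<Rightarrow> real) \<Rightarrow> real"
  where "mean M g = (LINT x|M. g x)"

definition gram :: "real measure \<Rightarrow> real poly \<Rightarrow> real poly \<Rightarrow> real"
  where "gram M p q = mean M (\<lambda>x. poly p x * poly q x)"

definition gram_f :: "real measure \<Rightarrow> (real \<Rightarrow> real) \<Rightarrow> real poly \<Rightarrow> real poly \<Rightarrow> real"
  where "gram_f M f p q = mean M (\<lambda>x. poly p x * f x * poly q x)"

text \<open>
  The entries \<open>A j k\<close> with \<open>j, k < n\<close> form the matrix. Symmetry is part of the notion; a Gram matrix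
  satisfies it automatically.
\<close>
definition pos_def_matrix :: "nat \<Rightarrow> (nat \<Rightarrow> nat \<Rightarrow> real) \<Rightarrow> bool"
  where "pos_def_matrix n A \<longleftrightarrow>
    (\<forall>j<n. \<forall>k<n. A j k = A k j) \<and>
    (\<forall>v. (\<exists>k<n. v k \<noteq> 0) \<longrightarrow> 0 < (\<Sum>j<n. \<Sum>k<n. v j * A j k * v k))"

text \<open>
  The \<open>\<sigma>\<close>-algebra of \<open>M\<close> contains the Borel sets but may be larger, so Borel measures and their
  completions are both covered. The condition \<open>Q k \<noteq> 0\<close> is needed because the zero polynomial has
  degree \<open>0\<close> here.
\<close>
definition quadrature_setting ::
  "nat \<Rightarrow> real measure \<Rightarrow> (real \<Rightarrow> real) \<Rightarrow> (nat \<Rightarrow> real poly) \<Rightarrow> bool"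
  where "quadrature_setting n M f Q \<longleftrightarrow>
    space M = UNIV \<and> sets borel \<subseteq> sets M \<and>
    (\<forall>k. Q k \<noteq> 0 \<and> degree (Q k) = k) \<and>
    (\<forall>j<n. \<forall>k<n. integrable M (\<lambda>x. poly (Q j) x * poly (Q k) x)) \<and>
    (\<forall>j<n. \<forall>k<n. integrable M (\<lambda>x. poly (Q j) x * f x * poly (Q k) x)) \<and>
    pos_def_matrix n (\<lambda>j k. gram M (Q j) (Q k))"

text \<open>
  The quadrature is the family of pairs \<open>(lam i, psi i)\<close> with \<open>i < n\<close>: a full orthonormal set of
  solutions of the generalized eigenvalue problem, \<open>\<alpha> i k\<close> being the coefficient of \<open>Q k\<close> in
  \<open>psi i\<close>. The relations \<open>gram_f M f (psi i) (psi j) = (if i = j then lam i else 0)\<close> follow.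
\<close>
definition lebesgue_quadrature ::
  "nat \<Rightarrow> real measure \<Rightarrow> (real \<Rightarrow> real) \<Rightarrow> (nat \<Rightarrow> real poly) \<Rightarrow>
   (nat \<Rightarrow> real) \<Rightarrow> (nat \<Rightarrow> real poly) \<Rightarrow> bool"
  where "lebesgue_quadrature n M f Q lam psi \<longleftrightarrow>
    (\<exists>\<alpha> :: nat \<Rightarrow> nat \<Rightarrow> real.
      (\<forall>i<n. psi i = (\<Sum>k<n. smult (\<alpha> i k) (Q k))) \<and>
      (\<forall>i<n. \<forall>j<n. (\<Sum>k<n. gram_f M f (Q j) (Q k) * \<alpha> i k) =
                    lam i * (\<Sum>k<n. gram M (Q j) (Q k) * \<alpha> i k))) \<and>
    (\<forall>i<n. \<forall>j<n. gram M (psi i) (psi j) = (if i = j then 1 else 0))"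

end

theory Submission imports Defs
begin

text \<open>
  An orthonormal family of \<open>n\<close> polynomials of degree below \<open>n\<close> spans all such polynomials, and every
  monomial of degree at most \<open>2 n - 2\<close> is a product of two of them. Hence
  \<open>P = (\<Sum>i j. c i j * psi i * psi j)\<close> for some coefficients \<open>c\<close>, and since
  \<open>gram_f M f (psi i) (psi j)\<close> is \<open>lam i\<close> for \<open>i = j\<close> and \<open>0\<close> otherwise, the integral of \<open>P * f\<close> is
  \<open>\<Sum>i. c i i * lam i\<close>. This holds for every choice of \<open>c\<close>, so one may be picked from \<open>P\<close> and
  \<open>psi\<close> alone.
\<close>

text \<open>Taking \<open>f\<close> constantly \<open>1\<close> lets the bilinear expansion of
  \<open>gram_f\<close> serve for plain Gram products as well.\<close>

lemma gram_eq_gram_f: "gram M p q = gram_f M (\<lambda>_. 1) p q"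
  by (simp add: gram_def gram_f_def)

lemma
  fixes h :: "nat \<Rightarrow> nat \<Rightarrow> 'a \<Rightarrow> real"
  assumes int: "\<And>j k. j < m \<Longrightarrow> k < n \<Longrightarrow> integrable M (h j k)"
  shows integrable_double_sum: "integrable M (\<lambda>x. \<Sum>j<m. \<Sum>k<n. c j k * h j k x)"
    and integral_double_sum: "(LINT x|M. (\<Sum>j<m. \<Sum>k<n. c j k * h j k x)) =
      (\<Sum>j<m. \<Sum>k<n. c j k * (LINT x|M. h j k x))"
proof -
  have inner: "integrable M (\<lambda>x. \<Sum>k<n. c j k * h j k x)" if "j < m" for j
    using that by (intro Bochner_Integration.integrable_sum integrable_mult_right int) auto
  then show "integrable M (\<lambda>x. \<Sum>j<m. \<Sum>k<n. c j k * h j k x)"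
    by (intro Bochner_Integration.integrable_sum) (auto simp: int)
  have "(LINT x|M. (\<Sum>k<n. c j k * h j k x)) = (\<Sum>k<n. c j k * (LINT x|M. h j k x))"
    if "j < m" for j
    using that by (simp add: Bochner_Integration.integral_sum int)
  then show "(LINT x|M. (\<Sum>j<m. \<Sum>k<n. c j k * h j k x)) =
      (\<Sum>j<m. \<Sum>k<n. c j k * (LINT x|M. h j k x))"
    using inner by (simp add: Bochner_Integration.integral_sum)
qed

text \<open>Bilinearity of the integral in its two polynomial factors. The two families and their
  lengths are kept separate so that one factor may also be a single polynomial, written as a sum of
  length \<open>1\<close>.\<close>

lemma
  fixes Q R :: "nat \<Rightarrow> real poly"
  assumes int: "\<And>j k. j < m \<Longrightarrow> k < n \<Longrightarrow> integrable M (\<lambda>x. poly (Q j) x * f x * poly (R k) x)"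
    and p: "p = (\<Sum>j<m. smult (a j) (Q j))"
    and q: "q = (\<Sum>k<n. smult (b k) (R k))"
  shows integrable_gram_f_sum: "integrable M (\<lambda>x. poly p x * f x * poly q x)"
    and gram_f_sum: "gram_f M f p q = (\<Sum>j<m. \<Sum>k<n. a j * b k * gram_f M f (Q j) (R k))"
proof -
  have eq: "poly p x * f x * poly q x =
      (\<Sum>j<m. \<Sum>k<n. a j * b k * (poly (Q j) x * f x * poly (R k) x))" for x
    unfolding p q poly_sum poly_smult sum_distrib_left sum_distrib_right
    by (subst sum.swap) (simp add: mult_ac)
  show "integrable M (\<lambda>x. poly p x * f x * poly q x)"
    unfolding eq by (rule integrable_double_sum[OF int])
  show "gram_f M f p q = (\<Sum>j<m. \<Sum>k<n. a j * b k * gram_f M f (Q j) (R k))"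
    unfolding gram_f_def mean_def eq
    by (rule integral_double_sum[OF int])
qed

text \<open>Provides span, independence and the bound of an independent set by a spanning set, on
  which the dimension count below rests.\<close>

interpretation poly_vs: vector_space "smult :: real \<Rightarrow> real poly \<Rightarrow> real poly"
  by unfold_locales (simp_all add: smult_add_right smult_add_left)

lemma degree_less_in_span_monoms:
  assumes "degree p < n"
  shows "p \<in> poly_vs.span ((\<lambda>k. monom 1 k) ` {..<n})"
proof -
  have "p = (\<Sum>i\<le>degree p. smult (coeff p i) (monom 1 i))"
    by (simp add: smult_monom poly_as_sum_of_monoms)
  also have "\<dots> \<in> poly_vs.span ((\<lambda>k. monom 1 k) ` {..<n})"
    using assms by (intro poly_vs.span_sum poly_vs.span_scale poly_vs.span_base) auto
  finally show ?thesis .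
qed

text \<open>Dimension count: a \<open>p\<close> outside the span would extend the family to
  \<open>n + 1\<close> independent polynomials inside a space spanned by \<open>n\<close>
  monomials.\<close>

lemma span_independent_degree_less:
  fixes psi :: "nat \<Rightarrow> real poly"
  assumes deg: "\<And>i. i < n \<Longrightarrow> degree (psi i) < n"
    and indep: "\<And>u j. (\<Sum>i<n. smult (u i) (psi i)) = 0 \<Longrightarrow> j < n \<Longrightarrow> u j = 0"
    and p: "degree p < n"
  shows "\<exists>d. p = (\<Sum>i<n. smult (d i) (psi i))"
proof -
  let ?S = "psi ` {..<n}" and ?T = "(\<lambda>k. monom (1::real) k) ` {..<n}"
  have inj: "inj_on psi {..<n}"
  proof (rule inj_onI)
    fix i j assume ij: "i \<in> {..<n}" "j \<in> {..<n}" "psi i = psi j"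
    \<comment> \<open>Difference of the indicators of \<open>i\<close> and \<open>j\<close>: it
      yields a vanishing combination when \<open>psi i = psi j\<close>, while \<open>u i = 1\<close>
      unless \<open>i = j\<close>.\<close>
    define u where "u k = (if k = i then 1 else 0) - (if k = j then 1 else (0::real))" for k
    have "(\<Sum>k<n. smult (u k) (psi k)) =
      (\<Sum>k<n. if k = i then psi k else 0) - (\<Sum>k<n. if k = j then psi k else 0)"
      unfolding sum_subtractf[symmetric] by (intro sum.cong) (auto simp: u_def)
    also have "\<dots> = 0" using ij by (simp add: sum.delta)
    finally have "u i = 0" using indep ij(1) by blast
    then show "i = j" by (simp add: u_def split: if_splits)
  qed
  have ind: "poly_vs.independent ?S"
  proof (rule poly_vs.independent_if_scalars_zero)
    fix u q assume u: "(\<Sum>v\<in>?S. smult (u v) v) = 0" and q: "q \<in> ?S"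
    from u have "(\<Sum>i<n. smult (u (psi i)) (psi i)) = 0"
      by (simp add: sum.reindex[OF inj])
    with q show "u q = 0" using indep[of "\<lambda>i. u (psi i)"] by auto
  qed simp
  have "p \<in> poly_vs.span ?S"
  proof (rule ccontr)
    assume np: "p \<notin> poly_vs.span ?S"
    then have "poly_vs.independent (insert p ?S)"
      using ind by (rule poly_vs.independent_insertI)
    moreover have "insert p ?S \<subseteq> poly_vs.span ?T"
      using degree_less_in_span_monoms deg p by auto
    ultimately have "card (insert p ?S) \<le> card ?T"
      using poly_vs.independent_span_bound[of ?T "insert p ?S"] by simp
    moreover have "p \<notin> ?S" using np poly_vs.span_base[of p ?S] by metis
    moreover have "card ?T \<le> n" using card_image_le[of "{..<n}" "\<lambda>k. monom (1::real) k"] by simp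
    ultimately show False by (simp add: card_image[OF inj])
  qed
  then obtain u where "p = (\<Sum>v\<in>?S. smult (u v) v)"
    using poly_vs.span_finite[of ?S] by auto
  then have "p = (\<Sum>i<n. smult (u (psi i)) (psi i))"
    by (simp add: sum.reindex[OF inj])
  then show ?thesis by (rule exI[where x="\<lambda>i. u (psi i)"])
qed

lemma sum_products_of_spanning:
  fixes psi :: "nat \<Rightarrow> real poly"
  assumes span: "\<And>p. degree p < n \<Longrightarrow> \<exists>d. p = (\<Sum>i<n. smult (d i) (psi i))"
    and n: "n \<ge> 1" and P: "degree P \<le> 2 * n - 2"
  shows "\<exists>c. P = (\<Sum>i<n. \<Sum>j<n. smult (c i j) (psi i * psi j))"
proof -
  \<comment> \<open>The first exponent takes as much of \<open>k\<close> as \<open>n - 1\<close>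
    allows, so the rest \<open>b k\<close> is at most
    \<open>(2 * n - 2) - (n - 1) = n - 1\<close>.\<close>
  define a where "a k = min k (n - 1)" for k
  define b where "b k = k - a k" for k
  have lt: "a k < n" "b k < n" "a k + b k = k" if "k \<le> 2 * n - 2" for k
    using that n by (auto simp: a_def b_def)
  have "\<exists>d. monom 1 m = (\<Sum>i<n. smult (d i) (psi i))" if "m < n" for m
    using that by (intro span) (simp add: degree_monom_eq)
  then obtain d where d: "\<And>m. m < n \<Longrightarrow> monom 1 m = (\<Sum>i<n. smult (d m i) (psi i))"
    by metis
  \<comment> \<open>Collects, over all monomials of \<open>P\<close>, the coefficient of
    \<open>psi i * psi j\<close> in the product of the two expanded factors. Terms with
    \<open>k\<close> above the degree of \<open>P\<close> vanish.\<close>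
  define c where "c i j = (\<Sum>k\<le>2 * n - 2. coeff P k * d (a k) i * d (b k) j)" for i j
  have "P = (\<Sum>k\<le>2 * n - 2. monom (coeff P k) k)"
    by (rule poly_as_sum_of_monoms'[OF P, symmetric])
  also have "\<dots> = (\<Sum>k\<le>2 * n - 2. \<Sum>i<n. \<Sum>j<n.
      smult (coeff P k * d (a k) i * d (b k) j) (psi i * psi j))"
  proof (rule sum.cong[OF refl])
    fix k assume "k \<in> {..2 * n - 2}"
    then have k: "k \<le> 2 * n - 2" by simp
    have "monom (coeff P k) k = smult (coeff P k) (monom 1 (a k) * monom 1 (b k))"
      using lt(3)[OF k] by (simp add: mult_monom smult_monom)
    also have "\<dots> = (\<Sum>i<n. \<Sum>j<n. smult (coeff P k * d (a k) i * d (b k) j) (psi i * psi j))"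
      unfolding d[OF lt(1)[OF k]] d[OF lt(2)[OF k]] sum_product poly_vs.scale_sum_right
      by (simp add: mult_ac)
    finally show "monom (coeff P k) k = \<dots>" .
  qed
  also have "\<dots> = (\<Sum>i<n. \<Sum>j<n. smult (c i j) (psi i * psi j))"
    unfolding c_def poly_vs.scale_sum_left
    \<comment> \<open>The sum over \<open>k\<close> moves inward, first past \<open>i\<close>, then
      past \<open>j\<close>.\<close>
    by (subst sum.swap, rule sum.cong[OF refl], rule sum.swap)
  finally show ?thesis by blast
qed

context
  fixes n M f Q lam psi
  assumes setting: "quadrature_setting n M f Q" and quad: "lebesgue_quadrature n M f Q lam psi"
begin

lemma integrable_f_eigenfunctions:
  assumes "i < n" "j < n"
  shows "integrable M (\<lambda>x. poly (psi i) x * f x * poly (psi j) x)"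
proof -
  from quad obtain \<alpha> where psi: "\<And>i. i < n \<Longrightarrow> psi i = (\<Sum>k<n. smult (\<alpha> i k) (Q k))"
    unfolding lebesgue_quadrature_def by blast
  show ?thesis
    using setting
    by (intro integrable_gram_f_sum[OF _ psi psi] assms) (simp add: quadrature_setting_def)
qed

text \<open>The factor \<open>1\<close> keeps the integrand in the shape of \<open>gram_f\<close>
  with constant weight, as \<open>gram_f_sum\<close> expects.\<close>

lemma integrable_eigenfunctions:
  assumes "i < n" "j < n"
  shows "integrable M (\<lambda>x. poly (psi i) x * 1 * poly (psi j) x)"
proof -
  from quad obtain \<alpha> where psi: "\<And>i. i < n \<Longrightarrow> psi i = (\<Sum>k<n. smult (\<alpha> i k) (Q k))"
    unfolding lebesgue_quadrature_def by blast
  show ?thesis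
    using setting
    by (intro integrable_gram_f_sum[OF _ psi psi] assms) (simp add: quadrature_setting_def)
qed

lemma gram_eigenfunctions:
  "i < n \<Longrightarrow> j < n \<Longrightarrow> gram M (psi i) (psi j) = (if i = j then 1 else 0)"
  using quad by (simp add: lebesgue_quadrature_def)

text \<open>Expanding both factors in \<open>Q\<close> exposes the left side of the eigenvalue
  equation for \<open>psi j\<close>. Replacing it and recombining gives \<open>lam j\<close> times
  the Gram product, to which orthonormality applies.\<close>

lemma gram_f_eigenfunctions:
  assumes i: "i < n" and j: "j < n"
  shows "gram_f M f (psi i) (psi j) = (if i = j then lam i else 0)"
proof -
  from quad obtain \<alpha> where psi: "\<And>i. i < n \<Longrightarrow> psi i = (\<Sum>k<n. smult (\<alpha> i k) (Q k))"
    and eig: "\<And>i j. i < n \<Longrightarrow> j < n \<Longrightarrow> (\<Sum>k<n. gram_f M f (Q j) (Q k) * \<alpha> i k) =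
                    lam i * (\<Sum>k<n. gram M (Q j) (Q k) * \<alpha> i k)"
    unfolding lebesgue_quadrature_def by blast
  have "gram_f M f (psi i) (psi j) = (\<Sum>k<n. \<Sum>l<n. \<alpha> i k * \<alpha> j l * gram_f M f (Q k) (Q l))"
    using setting by (intro gram_f_sum psi i j) (simp add: quadrature_setting_def)
  also have "\<dots> = (\<Sum>k<n. \<alpha> i k * (\<Sum>l<n. gram_f M f (Q k) (Q l) * \<alpha> j l))"
    by (simp add: sum_distrib_left mult_ac)
  also have "\<dots> = (\<Sum>k<n. \<alpha> i k * (lam j * (\<Sum>l<n. gram M (Q k) (Q l) * \<alpha> j l)))"
    using j by (simp add: eig)
  also have "\<dots> = lam j * (\<Sum>k<n. \<Sum>l<n. \<alpha> i k * \<alpha> j l * gram_f M (\<lambda>_. 1) (Q k) (Q l))"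
    by (simp add: sum_distrib_left mult_ac gram_eq_gram_f)
  also have "\<dots> = lam j * gram_f M (\<lambda>_. 1) (psi i) (psi j)"
    using setting
    by (subst gram_f_sum[OF _ psi[OF i] psi[OF j]]) (simp_all add: quadrature_setting_def)
  finally show ?thesis
    using gram_eigenfunctions[OF i j] by (simp add: gram_eq_gram_f)
qed

text \<open>Pairing the vanishing combination with \<open>psi j\<close> isolates \<open>u j\<close>
  by orthonormality.\<close>

lemma eigenfunctions_independent:
  assumes "(\<Sum>i<n. smult (u i) (psi i)) = 0" "j < n"
  shows "u j = 0"
proof -
  have "0 = gram_f M (\<lambda>_. 1) 0 (psi j)"
    by (simp add: gram_f_def mean_def)
  also have "\<dots> = (\<Sum>i<n. \<Sum>k<1::nat. u i * 1 * gram_f M (\<lambda>_. 1) (psi i) (psi j))"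
    using assms integrable_eigenfunctions
    by (intro gram_f_sum[where R="\<lambda>_. psi j" and b="\<lambda>_. 1"]) auto
  also have "\<dots> = (\<Sum>i<n. if i = j then u i else 0)"
    using assms(2) by (intro sum.cong) (auto simp: gram_eq_gram_f[symmetric] gram_eigenfunctions)
  also have "\<dots> = u j" using assms(2) by simp
  finally show ?thesis by simp
qed

lemma degree_eigenfunction:
  assumes "i < n"
  shows "degree (psi i) < n"
proof -
  from quad obtain \<alpha> where "\<forall>i<n. psi i = (\<Sum>k<n. smult (\<alpha> i k) (Q k))"
    unfolding lebesgue_quadrature_def by blast
  moreover have "degree (\<Sum>k<n. smult (\<alpha> i k) (Q k)) < n"
    using assms setting
    by (intro degree_sum_less) (auto simp: quadrature_setting_def intro: le_less_trans[OF degree_smult_le])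
  ultimately show ?thesis using assms by simp
qed

text \<open>The conclusion mentions neither \<open>M\<close> nor \<open>f\<close>, so suitable
  coefficients can be selected knowing \<open>psi\<close> and \<open>P\<close> only.\<close>

lemma eigenfunction_products_span:
  assumes "n \<ge> 1" "degree P \<le> 2 * n - 2"
  shows "\<exists>c. P = (\<Sum>i<n. \<Sum>j<n. smult (c i j) (psi i * psi j))"
proof (rule sum_products_of_spanning)
  show "\<exists>d. p = (\<Sum>i<n. smult (d i) (psi i))" if "degree p < n" for p
    using degree_eigenfunction eigenfunctions_independent that
    by (rule span_independent_degree_less)
qed (use assms in auto)

lemma
  assumes P: "P = (\<Sum>i<n. \<Sum>j<n. smult (c i j) (psi i * psi j))"
  shows integrable_sum_eigenfunction_products: "integrable M (\<lambda>x. poly P x * f x)"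
    and mean_sum_eigenfunction_products: "mean M (\<lambda>x. poly P x * f x) = (\<Sum>i<n. c i i * lam i)"
proof -
  have eq: "poly P x * f x =
      (\<Sum>i<n. \<Sum>j<n. c i j * (poly (psi i) x * f x * poly (psi j) x))" for x
    by (simp add: P poly_sum sum_distrib_left sum_distrib_right mult_ac)
  show "integrable M (\<lambda>x. poly P x * f x)"
    unfolding eq by (rule integrable_double_sum[OF integrable_f_eigenfunctions])
  have "mean M (\<lambda>x. poly P x * f x) = (\<Sum>i<n. \<Sum>j<n. c i j * gram_f M f (psi i) (psi j))"
    unfolding gram_f_def mean_def eq
    by (rule integral_double_sum[OF integrable_f_eigenfunctions])
  \<comment> \<open>Off-diagonal coefficients are annihilated, so the non-uniqueness of
    \<open>c\<close> does not affect the value.\<close>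
  also have "\<dots> = (\<Sum>i<n. \<Sum>j<n. if i = j then c i i * lam i else 0)"
    by (intro sum.cong) (auto simp: gram_f_eigenfunctions)
  finally show "mean M (\<lambda>x. poly P x * f x) = (\<Sum>i<n. c i i * lam i)"
    by (simp add: sum.delta)
qed

end

theorem theorem1:
  fixes n :: nat
  assumes "n \<ge> 1"
  shows "\<exists>E :: (real \<times> real poly) list \<Rightarrow> real poly \<Rightarrow> real.
    \<forall>(M :: real measure) (f :: real \<Rightarrow> real) (Q :: nat \<Rightarrow> real poly)
     (lam :: nat \<Rightarrow> real) (psi :: nat \<Rightarrow> real poly) (P :: real poly).
      quadrature_setting n M f Q \<longrightarrow>
      lebesgue_quadrature n M f Q lam psi \<longrightarrow>
      degree P \<le> 2 * n - 2 \<longrightarrow>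
      integrable M (\<lambda>x. poly P x * f x) \<and>
      mean M (\<lambda>x. poly P x * f x) = E (map (\<lambda>i. (lam i, psi i)) [0..<n]) P"
proof -
  \<comment> \<open>The choice sees only the list and \<open>P\<close>, which makes \<open>E\<close>
    a single functional serving all \<open>M\<close>, \<open>f\<close> and \<open>Q\<close>. It is
    arbitrary on lists whose products do not represent \<open>P\<close>.\<close>
  define coeffs :: "(real \<times> real poly) list \<Rightarrow> real poly \<Rightarrow> nat \<Rightarrow> nat \<Rightarrow> real" where
    "coeffs L P = (SOME c. P = (\<Sum>i<n. \<Sum>j<n. smult (c i j) (snd (L ! i) * snd (L ! j))))" for L P
  define E where "E L P = (\<Sum>i<n. coeffs L P i i * fst (L ! i))" for L P
  show ?thesis
  proof (intro exI[of _ E] allI impI)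
    fix M f Q lam psi and P :: "real poly"
    assume setting: "quadrature_setting n M f Q"
      and quad: "lebesgue_quadrature n M f Q lam psi"
      and deg: "degree P \<le> 2 * n - 2"
    let ?L = "map (\<lambda>i. (lam i, psi i)) [0..<n]"
    \<comment> \<open>For \<open>i < n\<close> the entry \<open>?L ! i\<close> is
      \<open>(lam i, psi i)\<close>, so the spanning property supplies the witness that makes the
      choice meaningful.\<close>
    have "\<exists>c. P = (\<Sum>i<n. \<Sum>j<n. smult (c i j) (snd (?L ! i) * snd (?L ! j)))"
      using eigenfunction_products_span[OF setting quad assms deg] by simp
    then have "P = (\<Sum>i<n. \<Sum>j<n. smult (coeffs ?L P i j) (snd (?L ! i) * snd (?L ! j)))"
      unfolding coeffs_def by (rule someI_ex)
    then have P: "P = (\<Sum>i<n. \<Sum>j<n. smult (coeffs ?L P i j) (psi i * psi j))"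
      by simp
    have "E ?L P = (\<Sum>i<n. coeffs ?L P i i * lam i)"
      by (simp add: E_def)
    with integrable_sum_eigenfunction_products[OF setting quad P]
      mean_sum_eigenfunction_products[OF setting quad P]
    show "integrable M (\<lambda>x. poly P x * f x) \<and> mean M (\<lambda>x. poly P x * f x) = E ?L P"
      by simp
  qed
qed

end
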